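(* Let $(X,* )$ be a Super Hayashi Quandle. Then $(X,* )$ is latin, and thus connected.
   Context: A quandle is a set $X$ with a binary operation $*$ such that for all $i,j,k\in X$: $i*i=i$; there is a unique $x\in X$ with $x*j=i$; and $(i*j)*k=(i*k)*(j*k)$. The right translation $R_i:X\to X$ is the permutation $R_i(j)=j*i$, and the left translation is $L_i(j)=i*j$. A quandle is latin if all its left translations are bijections. A quandle is connected if the group $\langle R_i: i\in X\rangle$ acts transitively on $X$. The cycle structure of a permutation of a finite set is the list of the lengths (with multiplicity, fixed points included) of its disjoint cycles. A Super Hayashi Quandle (SHQ) is a finite quandle each of whose right translations has cycle structure of the form $(\ell_1,\dots,\ell_c)$ with $1=\ell_1<\ell_2<\dots<\ell_c$, $c\geq2$, and $\ell_{i-1}\mid\ell_i$ for each $i\in\{2,\dots,c\}$. *)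

theory Defs
  imports
    "HOL-Algebra.Group_Action"
    "HOL-Algebra.Generated_Groups"
    "HOL-Combinatorics.Orbits"
    "HOL-Library.Multiset"
begin

locale quandle =
  fixes X :: "'a set" and op :: "'a \<Rightarrow> 'a \<Rightarrow> 'a" (infixl "\<star>" 70)
  assumes closed: "i \<in> X \<Longrightarrow> j \<in> X \<Longrightarrow> i \<star> j \<in> X"
    and idem: "i \<in> X \<Longrightarrow> i \<star> i = i"
    and right_div: "i \<in> X \<Longrightarrow> j \<in> X \<Longrightarrow> \<exists>!x. x \<in> X \<and> x \<star> j = i"
    and right_distrib:
      "i \<in> X \<Longrightarrow> j \<in> X \<Longrightarrow> k \<in> X \<Longrightarrow> (i \<star> j) \<star> k = (i \<star> k) \<star> (j \<star> k)"

text \<open>Translations are restricted to \<open>X\<close> (undefined outside it), so that the right translations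
  of a quandle are elements of \<^term>\<open>carrier (BijGroup X)\<close>.\<close>

definition right_translation :: "'a set \<Rightarrow> ('a \<Rightarrow> 'a \<Rightarrow> 'a) \<Rightarrow> 'a \<Rightarrow> 'a \<Rightarrow> 'a" where
  "right_translation X op i = (\<lambda>j\<in>X. op j i)"

definition left_translation :: "'a set \<Rightarrow> ('a \<Rightarrow> 'a \<Rightarrow> 'a) \<Rightarrow> 'a \<Rightarrow> 'a \<Rightarrow> 'a" where
  "left_translation X op i = (\<lambda>j\<in>X. op i j)"

lemma (in quandle) right_translation_Bij:
  assumes "i \<in> X"
  shows "right_translation X op i \<in> carrier (BijGroup X)"
proof -
  have "bij_betw (right_translation X op i) X X"
    unfolding right_translation_def bij_betw_def inj_on_def
    using closed right_div assms by (auto simp: image_iff) (metis+)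
  then show ?thesis
    by (simp add: BijGroup_def Bij_def right_translation_def)
qed

definition latin_quandle :: "'a set \<Rightarrow> ('a \<Rightarrow> 'a \<Rightarrow> 'a) \<Rightarrow> bool" where
  "latin_quandle X op \<longleftrightarrow>
     quandle X op \<and> (\<forall>i\<in>X. bij_betw (left_translation X op i) X X)"

definition right_mult_group :: "'a set \<Rightarrow> ('a \<Rightarrow> 'a \<Rightarrow> 'a) \<Rightarrow> ('a \<Rightarrow> 'a) monoid" where
  "right_mult_group X op =
     (BijGroup X) \<lparr>carrier := generate (BijGroup X) (right_translation X op ` X)\<rparr>"

definition connected_quandle :: "'a set \<Rightarrow> ('a \<Rightarrow> 'a \<Rightarrow> 'a) \<Rightarrow> bool" where
  "connected_quandle X op \<longleftrightarrow>
     quandle X op \<and> transitive_action (right_mult_group X op) X (\<lambda>g. g)"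

text \<open>The cycle structure of a permutation \<open>f\<close> of a finite set \<open>X\<close>. As the order of the cycle
  lengths is immaterial, it is a multiset; \<^const>\<open>mset_set\<close> ranges over the set of
  cycles, so equal lengths of distinct cycles are counted separately. The cycle through a fixed
  point \<open>x\<close> is \<open>{x}\<close>, of length 1.\<close>

definition cycle_structure :: "'a set \<Rightarrow> ('a \<Rightarrow> 'a) \<Rightarrow> nat multiset" where
  "cycle_structure X f = image_mset card (mset_set (Orbits.orbit f ` X))"

text \<open>Lists are indexed from 0: \<open>ls ! (i - 1)\<close> is the \<open>i\<close>-th length.\<close>

definition SHQ_cycle_lengths :: "nat list \<Rightarrow> bool" where
  "SHQ_cycle_lengths ls \<longleftrightarrow>
     length ls \<ge> 2 \<and> ls ! 0 = 1 \<and>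
     (\<forall>i. 0 < i \<and> i < length ls \<longrightarrow> ls ! (i - 1) < ls ! i \<and> ls ! (i - 1) dvd ls ! i)"

locale super_hayashi_quandle = quandle +
  assumes finite_carrier: "finite X"
    and SHQ_cycle_structure: "i \<in> X \<Longrightarrow>
      \<exists>ls. SHQ_cycle_lengths ls \<and> cycle_structure X (right_translation X op i) = mset ls"

end

theory Submission
  imports Defs
begin

text \<open>
  The property that drives the argument is that the cycle lengths of each right translation are
  pairwise distinct and totally ordered by divisibility. Unlike the full Super Hayashi condition,
  it passes to every subquandle, one-element subquandles included, because the cycles of a right
  translation of the subquandle are cycles of the ambient one. This permits an induction on the
  cardinality in which all proper subquandles are already latin (lemma \<open>left_translation_surj_step\<close>).

  Let \<open>T\<close> be the longest cycle of \<open>R\<^sub>i\<close> and \<open>Y = X - T\<close>. A sum of distinct proper divisors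
  of \<open>n\<close> that form a divisibility chain is less than \<open>n\<close>, so \<open>T\<close> contains more than half of \<open>X\<close>.
  The points of \<open>X\<close> whose \<open>R\<^sub>i\<close>-period divides a given number form a subquandle, since \<open>R\<^sub>i\<close> is an
  automorphism. Any two points of \<open>Y\<close> lie in one of these subquandles that avoids \<open>T\<close>, because
  one of their periods divides the other; hence \<open>Y\<close> is a proper subquandle. Unless \<open>X = {i}\<close>, it
  contains \<open>i\<close>, and \<open>L\<^sub>i\<close> maps it onto itself. As \<open>L\<^sub>i\<close>
  commutes with \<open>R\<^sub>i\<close>, it maps \<open>T\<close> either onto \<open>T\<close>, in which case it is surjective on \<open>X\<close>, or
  into \<open>Y\<close>.

  Suppose that \<open>L\<^sub>i\<close> maps \<open>T\<close> into \<open>Y\<close>. Then \<open>i * x \<in> Y\<close> for all \<open>x \<in> X\<close>, and transporting this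
  along the right translations \<open>R\<^sub>z\<close> with \<open>z \<in> Y\<close>, which move \<open>i\<close> to any point of \<open>Y\<close>, gives
  \<open>y * x \<in> Y\<close> for all \<open>y \<in> Y\<close> and \<open>x \<in> X\<close>. Pick \<open>j \<in> T\<close>. The \<open>R\<^sub>j\<close>-cycle of \<open>i\<close> lies in \<open>Y\<close>, which
  has fewer than half of the points, so it is not the longest cycle of \<open>R\<^sub>j\<close>. Therefore the points
  whose \<open>R\<^sub>j\<close>-period divides that of \<open>i\<close> form a proper subquandle \<open>W\<close>, which contains \<open>i\<close> and \<open>j\<close>.
  Both \<open>W\<close> and \<open>W \<inter> Y\<close> are latin, so \<open>i * j \<in> W \<inter> Y\<close> is \<open>i * z\<close> for some \<open>z \<in> W \<inter> Y\<close>, and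
  injectivity of \<open>L\<^sub>i\<close> on \<open>W\<close> gives \<open>j = z \<in> Y\<close>, a contradiction.

  Connectedness follows at once: solving \<open>i * x = j\<close> provides a right translation that moves \<open>i\<close>
  to \<open>j\<close>.
\<close>

section \<open>Cycles of a permutation of a finite set\<close>

lemma self_in_orbit_of_bij_betw:
  assumes "finite X" "bij_betw f X X" "x \<in> X"
  shows "x \<in> Orbits.orbit f x"
proof -
  have "perm_restrict f X permutes X"
    using assms(2) bij_betw_cong[of X "perm_restrict f X" f X]
    by (intro bij_imp_permutes) (auto simp: perm_restrict_def)
  then have "x \<in> Orbits.orbit (perm_restrict f X) x"
    using assms(1) permutation_permutes permutation_self_in_orbit by metis
  also have "Orbits.orbit (perm_restrict f X) x = Orbits.orbit f x"
    using assms(2,3) bij_betw_apply[OF assms(2)]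
    by (intro orbit_cong0[of x X]) (auto simp: perm_restrict_def)
  finally show ?thesis .
qed

lemma orbit_subset_of_closed:
  assumes "\<And>x. x \<in> X \<Longrightarrow> f x \<in> X" "x \<in> X"
  shows "Orbits.orbit f x \<subseteq> X"
proof
  fix y assume "y \<in> Orbits.orbit f x"
  then show "y \<in> X" by induct (auto simp: assms)
qed

lemma orbit_eq_of_mem:
  assumes "x \<in> Orbits.orbit f x" "y \<in> Orbits.orbit f x"
  shows "Orbits.orbit f y = Orbits.orbit f x"
  using assms by (meson orbit_swap orbit_trans subsetI subset_antisym)

lemma funpow_fixes_iff_card_orbit_dvd:
  assumes "x \<in> Orbits.orbit f x"
  shows "(f ^^ d) x = x \<longleftrightarrow> card (Orbits.orbit f x) dvd d"
proof -
  define p where "p = funpow_dist1 f x x"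
  have card: "card (Orbits.orbit f x) = p"
    using card_image[OF inj_on_funpow_dist1[OF assms]] orbit_conv_funpow_dist1[OF assms]
    unfolding p_def by simp
  have period: "(f ^^ p) x = x"
    unfolding p_def by (rule funpow_dist1_prop[OF assms])
  have "(f ^^ (d mod p)) x = (f ^^ d) x"
    using funpow_mod_eq[OF period] .
  moreover have "(f ^^ r) x \<noteq> x" if "0 < r" "r < p" for r
    using funpow_dist1_least that unfolding p_def by metis
  moreover have "d mod p < p"
    unfolding p_def by simp
  ultimately have "(f ^^ d) x = x \<longleftrightarrow> d mod p = 0"
    by (metis funpow_0 neq0_conv)
  then show ?thesis by (simp add: card dvd_eq_mod_eq_0)
qed

text \<open>The implication from equal cardinalities to equal cycles says that distinct cycles have
  distinct lengths. Quantifying over points makes the condition monotone in \<open>X\<close>.\<close>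

definition chain_cycles :: "'a set \<Rightarrow> ('a \<Rightarrow> 'a) \<Rightarrow> bool" where
  "chain_cycles X f \<longleftrightarrow>
     (\<forall>x\<in>X. \<forall>y\<in>X.
        (card (Orbits.orbit f x) dvd card (Orbits.orbit f y) \<or>
         card (Orbits.orbit f y) dvd card (Orbits.orbit f x)) \<and>
        (card (Orbits.orbit f x) = card (Orbits.orbit f y) \<longrightarrow>
         Orbits.orbit f x = Orbits.orbit f y))"

lemma chain_cycles_subset: "chain_cycles X f \<Longrightarrow> Y \<subseteq> X \<Longrightarrow> chain_cycles Y f"
  unfolding chain_cycles_def by (meson subsetD)

text \<open>The largest element \<open>m\<close> of the chain satisfies \<open>2 * m \<le> n\<close>, and the other elements are
  proper divisors of \<open>m\<close>, so that inductively their sum is less than \<open>m\<close>.\<close>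

lemma sum_proper_divisor_chain_less:
  fixes S :: "nat set"
  assumes "finite S" "0 < n"
    and "\<And>s. s \<in> S \<Longrightarrow> s dvd n \<and> s \<noteq> n"
    and "\<And>s t. s \<in> S \<Longrightarrow> t \<in> S \<Longrightarrow> s dvd t \<or> t dvd s"
  shows "\<Sum>S < n"
  using assms
proof (induction n arbitrary: S rule: less_induct)
  case (less n)
  show ?case
  proof (cases "S = {}")
    case False
    define m where "m = Max S"
    have m: "m \<in> S" unfolding m_def using False less.prems(1) by simp
    then have mn: "m dvd n" "m \<noteq> n" using less.prems(3) by auto
    then have pos: "0 < m" and "m < n"
      using less.prems(2) by (auto intro: dvd_pos_nat dest: dvd_imp_le)
    have "s dvd m \<and> s \<noteq> m" if "s \<in> S - {m}" for s
    proof -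
      have "s \<le> m" "s dvd m \<or> m dvd s" "0 < s"
        using that m less.prems by (auto simp: m_def intro: dvd_pos_nat)
      then show ?thesis using that by (auto dest: dvd_imp_le)
    qed
    then have "\<Sum>(S - {m}) < m"
      using less.prems \<open>m < n\<close> pos by (intro less.IH) auto
    moreover have "\<Sum>S = m + \<Sum>(S - {m})"
      using less.prems(1) m by (simp add: sum.remove)
    moreover have "2 * m \<le> n"
    proof -
      obtain k where k: "n = m * k" using mn(1) ..
      then have "k \<noteq> 0" "k \<noteq> 1" using mn less.prems(2) by auto
      then have "2 \<le> k" by simp
      then show ?thesis using k by (simp add: mult.commute)
    qed
    ultimately show ?thesis by simp
  qed (use less.prems in simp)
qed

text \<open>The lengths of the cycles other than the longest one form a chain of its proper divisors, and
  they are pairwise distinct, so that the sum over cycles is a sum over a set of numbers.\<close>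

lemma obtain_dominant_cycle:
  assumes fin: "finite X" and bij: "bij_betw f X X" and chain: "chain_cycles X f"
    and ne: "X \<noteq> {}"
  obtains t where "t \<in> X"
    and "\<And>x. x \<in> X \<Longrightarrow> card (Orbits.orbit f x) dvd card (Orbits.orbit f t)"
    and "card X < 2 * card (Orbits.orbit f t)"
proof -
  let ?c = "\<lambda>x. card (Orbits.orbit f x)"
  have self: "x \<in> Orbits.orbit f x" if "x \<in> X" for x
    using self_in_orbit_of_bij_betw fin bij that .
  have sub: "Orbits.orbit f x \<subseteq> X" if "x \<in> X" for x
    using orbit_subset_of_closed[of X f] bij_betw_apply[OF bij] that by blast
  have finO: "finite (Orbits.orbit f x)" if "x \<in> X" for x
    using finite_orbit[OF self[OF that]] .
  have pos: "0 < ?c x" if "x \<in> X" for x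
    using finO self that by (auto simp: card_gt_0_iff)
  obtain t where t: "t \<in> X" and max: "\<And>x. x \<in> X \<Longrightarrow> ?c x \<le> ?c t"
  proof -
    have "Max (?c ` X) \<in> ?c ` X" using fin ne by (intro Max_in) auto
    then obtain t where "t \<in> X" "?c t = Max (?c ` X)" by auto
    then show ?thesis using that fin by (metis Max_ge finite_imageI imageI)
  qed
  have dvd: "?c x dvd ?c t" if "x \<in> X" for x
    using chain t that max[OF that] pos[OF that] unfolding chain_cycles_def
    by (metis dvd_imp_le dvd_refl le_antisym)
  let ?F = "Orbits.orbit f ` X"
  let ?T = "Orbits.orbit f t"
  have "pairwise disjnt ?F"
  proof (rule pairwiseI)
    fix A B assume "A \<in> ?F" "B \<in> ?F" "A \<noteq> B"
    then show "disjnt A B"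
      unfolding disjnt_iff using orbit_eq_of_mem self by (metis imageE)
  qed
  moreover have "\<Union> ?F = X" using self sub by blast
  ultimately have "card X = sum card ?F"
    using card_Union_disjoint[of ?F] finO by (metis imageE)
  also have "\<dots> = card ?T + sum card (?F - {?T})"
    using fin t by (intro sum.remove) auto
  also have "sum card (?F - {?T}) = \<Sum>(card ` (?F - {?T}))"
  proof -
    have "inj_on card (?F - {?T})"
      using chain unfolding chain_cycles_def inj_on_def by blast
    then show ?thesis by (simp add: sum.reindex)
  qed
  also have "\<dots> < card ?T"
  proof (rule sum_proper_divisor_chain_less)
    show "s dvd card ?T \<and> s \<noteq> card ?T" if "s \<in> card ` (?F - {?T})" for s
      using that dvd chain t unfolding chain_cycles_def by blast
    show "s dvd r \<or> r dvd s" if "s \<in> card ` (?F - {?T})" "r \<in> card ` (?F - {?T})" for s r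
      using that chain unfolding chain_cycles_def by blast
  qed (use fin t pos in auto)
  finally have "card X < 2 * card ?T" by simp
  then show ?thesis using that t dvd by blast
qed

section \<open>Quandles whose right translations have chain cycles\<close>

locale chain_cycle_quandle = quandle +
  assumes finite_carrier: "finite X"
    and chain: "i \<in> X \<Longrightarrow> chain_cycles X (\<lambda>x. x \<star> i)"
begin

abbreviation cycle :: "'a \<Rightarrow> 'a \<Rightarrow> 'a set" where
  "cycle i \<equiv> Orbits.orbit (\<lambda>x. x \<star> i)"

lemma bij_right: "i \<in> X \<Longrightarrow> bij_betw (\<lambda>x. x \<star> i) X X"
  unfolding bij_betw_def inj_on_def using closed right_div by (auto simp: image_iff) (metis+)

lemma self_in_cycle: "i \<in> X \<Longrightarrow> x \<in> X \<Longrightarrow> x \<in> cycle i x"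
  using self_in_orbit_of_bij_betw finite_carrier bij_right by metis

lemma cycle_subset: "i \<in> X \<Longrightarrow> x \<in> X \<Longrightarrow> cycle i x \<subseteq> X"
  using orbit_subset_of_closed[of X] closed by metis

lemma cycle_eq: "i \<in> X \<Longrightarrow> x \<in> X \<Longrightarrow> y \<in> cycle i x \<Longrightarrow> cycle i y = cycle i x"
  using orbit_eq_of_mem self_in_cycle by metis

lemma funpow_right_fixes_iff:
  "i \<in> X \<Longrightarrow> x \<in> X \<Longrightarrow> ((\<lambda>x. x \<star> i) ^^ d) x = x \<longleftrightarrow> card (cycle i x) dvd d"
  using funpow_fixes_iff_card_orbit_dvd self_in_cycle by metis

lemma funpow_right_closed: "i \<in> X \<Longrightarrow> x \<in> X \<Longrightarrow> ((\<lambda>x. x \<star> i) ^^ d) x \<in> X"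
  by (induction d) (auto simp: closed)

lemma funpow_right_hom:
  assumes "i \<in> X" "x \<in> X" "y \<in> X"
  shows "((\<lambda>x. x \<star> i) ^^ d) (x \<star> y) = ((\<lambda>x. x \<star> i) ^^ d) x \<star> ((\<lambda>x. x \<star> i) ^^ d) y"
  using assms by (induction d) (auto simp: right_distrib funpow_right_closed)

text \<open>For a fixed \<open>d\<close>, the set \<open>{x \<in> X. card (cycle i x) dvd d}\<close> is the set of fixed points of
  the automorphism \<open>R\<^sub>i ^ d\<close>.\<close>

lemma card_cycle_mult_dvd:
  assumes "i \<in> X" "x \<in> X" "y \<in> X" "card (cycle i x) dvd d" "card (cycle i y) dvd d"
  shows "card (cycle i (x \<star> y)) dvd d"
proof -
  have "((\<lambda>x. x \<star> i) ^^ d) x = x" "((\<lambda>x. x \<star> i) ^^ d) y = y"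
    using assms by (auto simp: funpow_right_fixes_iff)
  then have "((\<lambda>x. x \<star> i) ^^ d) (x \<star> y) = x \<star> y"
    using assms by (simp add: funpow_right_hom)
  then show ?thesis
    using assms closed by (simp add: funpow_right_fixes_iff)
qed

lemma cycle_self: "i \<in> X \<Longrightarrow> cycle i i = {i}"
  using orbit_eq_singleton_iff[of "\<lambda>x. x \<star> i" i] idem by simp

lemma subquandle:
  assumes "Y \<subseteq> X" and closed_Y: "\<And>a b. a \<in> Y \<Longrightarrow> b \<in> Y \<Longrightarrow> a \<star> b \<in> Y"
  shows "chain_cycle_quandle Y (\<star>)"
proof
  show "finite Y" using assms(1) finite_carrier by (rule finite_subset)
  show "chain_cycles Y (\<lambda>x. x \<star> i)" if "i \<in> Y" for i
    using chain_cycles_subset[OF chain assms(1)] that assms(1) by blast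
  show "\<exists>!x. x \<in> Y \<and> x \<star> j = i" if "i \<in> Y" "j \<in> Y" for i j
  proof -
    have inj: "inj_on (\<lambda>x. x \<star> j) Y"
      using bij_right[of j] that assms(1) by (meson bij_betw_imp_inj_on inj_on_subset subsetD)
    have "(\<lambda>x. x \<star> j) ` Y = Y"
      using closed_Y that \<open>finite Y\<close> inj by (intro endo_inj_surj) auto
    then obtain x where x: "x \<in> Y" "x \<star> j = i" using \<open>i \<in> Y\<close> by (metis imageE)
    then have "y = x" if "y \<in> Y" "y \<star> j = i" for y
      using inj_onD[OF inj, of y x] that by simp
    then show ?thesis using x by metis
  qed
  show "i \<star> j \<in> Y" if "i \<in> Y" "j \<in> Y" for i j using closed_Y that .
  show "i \<star> i = i" if "i \<in> Y" for i using idem that assms(1) by blast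
  show "(i \<star> j) \<star> k = (i \<star> k) \<star> (j \<star> k)" if "i \<in> Y" "j \<in> Y" "k \<in> Y" for i j k
    using right_distrib that assms(1) by blast
qed

text \<open>The inductive step of the argument in the introduction. On a finite carrier the latin property
  is surjectivity of left translations, a form that can be checked separately on a longest cycle and
  on its complement; injectivity is recovered on \<open>W\<close>, where the final contradiction uses it.\<close>

lemma left_translation_surj_step:
  assumes IH: "\<And>Y y. Y \<subset> X \<Longrightarrow> (\<And>a b. a \<in> Y \<Longrightarrow> b \<in> Y \<Longrightarrow> a \<star> b \<in> Y) \<Longrightarrow>
      y \<in> Y \<Longrightarrow> (\<lambda>x. y \<star> x) ` Y = Y"
    and i: "i \<in> X"
  shows "(\<lambda>x. i \<star> x) ` X = X"
proof -
  obtain t where t: "t \<in> X" and top: "\<And>x. x \<in> X \<Longrightarrow> card (cycle i x) dvd card (cycle i t)"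
    and half: "card X < 2 * card (cycle i t)"
    using obtain_dominant_cycle[OF finite_carrier bij_right[OF i] chain[OF i]] i by blast
  define T where "T = cycle i t"
  define Y where "Y = X - T"
  have TX: "T \<subseteq> X" and tT: "t \<in> T"
    unfolding T_def using cycle_subset self_in_cycle i t by blast+
  have T_iff: "x \<in> T \<longleftrightarrow> card (cycle i x) = card T" if "x \<in> X" for x
    using chain[OF i] t that self_in_cycle[OF i that] cycle_eq[OF i t]
    unfolding T_def chain_cycles_def by metis
  show ?thesis
  proof (cases "i \<in> T")
    case True
    \<comment> \<open>The fixed point \<open>i\<close> lies on a longest cycle, so every cycle has length 1, hence is \<open>T\<close>.\<close>
    then have "card T = 1" using T_iff[OF i] cycle_self[OF i] by simp
    then have "x \<in> T" if "x \<in> X" for x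
      using top[OF that] T_iff[OF that] by (simp add: T_def)
    then have "X = {i}" using \<open>card T = 1\<close> True TX by (auto simp: card_1_singleton_iff)
    then show ?thesis using idem by auto
  next
    case False
    then have iY: "i \<in> Y" using i by (simp add: Y_def)
    have YX: "Y \<subset> X" using tT t by (auto simp: Y_def)
    have closed_Y: "a \<star> b \<in> Y" if "a \<in> Y" "b \<in> Y" for a b
    proof -
      have ab: "a \<in> X" "b \<in> X" using that YX by auto
      \<comment> \<open>The two periods are comparable, so both divide the larger of them.\<close>
      obtain c where c: "c \<in> Y" "card (cycle i a) dvd card (cycle i c)"
          "card (cycle i b) dvd card (cycle i c)"
      proof -
        have "card (cycle i a) dvd card (cycle i b) \<or> card (cycle i b) dvd card (cycle i a)"
          using chain[OF i] ab unfolding chain_cycles_def by blast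
        then show thesis using that[of a] that[of b] \<open>a \<in> Y\<close> \<open>b \<in> Y\<close> by auto
      qed
      then have "card (cycle i (a \<star> b)) dvd card (cycle i c)"
        using card_cycle_mult_dvd i ab by blast
      moreover have "card (cycle i c) dvd card T" "card (cycle i c) \<noteq> card T"
        using c top T_iff YX by (auto simp: Y_def T_def)
      ultimately have "card (cycle i (a \<star> b)) \<noteq> card T" by (metis dvd_antisym)
      then show ?thesis using T_iff closed ab by (simp add: Y_def)
    qed
    have LY: "(\<lambda>x. y \<star> x) ` Y = Y" if "y \<in> Y" for y
      using IH YX closed_Y that by blast
    show ?thesis
    proof (cases "\<exists>x\<in>T. i \<star> x \<in> T")
      case True
      then obtain x where x: "x \<in> T" "i \<star> x \<in> T" by blast
      then have xX: "x \<in> X" using TX by blast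
      have "T \<subseteq> (\<lambda>x. i \<star> x) ` X"
      proof
        fix y assume "y \<in> T"
        then have "y \<in> cycle i (i \<star> x)"
          using cycle_eq[OF i t x(2)[unfolded T_def]] by (simp add: T_def)
        then obtain n where "y = ((\<lambda>x. x \<star> i) ^^ n) (i \<star> x)"
          by (auto simp: orbit_altdef)
        moreover have "((\<lambda>x. x \<star> i) ^^ n) i = i"
          using funpow_right_fixes_iff[OF i i] cycle_self[OF i] by simp
        ultimately have "y = i \<star> ((\<lambda>x. x \<star> i) ^^ n) x"
          using funpow_right_hom[OF i i xX] by simp
        then show "y \<in> (\<lambda>x. i \<star> x) ` X" using funpow_right_closed i xX by blast
      qed
      moreover have "Y \<subseteq> (\<lambda>x. i \<star> x) ` X" using LY[OF iY] YX by blast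
      ultimately show ?thesis using closed i by (auto simp: Y_def)
    next
      case False
      have i_to_Y: "i \<star> x \<in> Y" if "x \<in> X" for x
        using False that closed i closed_Y iY by (cases "x \<in> T") (auto simp: Y_def)
      have YX_to_Y: "y \<star> x \<in> Y" if "y \<in> Y" "x \<in> X" for y x
      proof -
        obtain z where z: "z \<in> Y" "y = i \<star> z" using LY[OF iY] \<open>y \<in> Y\<close> by blast
        then have zX: "z \<in> X" using YX by blast
        then obtain x' where "x' \<in> X" "x = x' \<star> z" using right_div \<open>x \<in> X\<close> by metis
        then have "y \<star> x = (i \<star> x') \<star> z" using z zX i right_distrib by simp
        then show ?thesis using i_to_Y \<open>x' \<in> X\<close> closed_Y z by simp
      qed
      obtain s where s: "s \<in> X" and tops: "\<And>x. x \<in> X \<Longrightarrow> card (cycle t x) dvd card (cycle t s)"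
        and halfs: "card X < 2 * card (cycle t s)"
        using obtain_dominant_cycle[OF finite_carrier bij_right[OF t] chain[OF t]] t by blast
      have "cycle t i \<subseteq> Y"
        using orbit_subset_of_closed[of Y "\<lambda>x. x \<star> t"] YX_to_Y t iY by blast
      then have "card (cycle t i) \<le> card Y"
        using finite_carrier YX by (meson card_mono finite_subset psubset_imp_subset)
      moreover have "card Y = card X - card T"
        unfolding Y_def using finite_carrier TX by (meson card_Diff_subset finite_subset)
      ultimately have "card (cycle t i) \<noteq> card (cycle t s)"
        using half halfs by (simp add: T_def)
      define W where "W = {x \<in> X. card (cycle t x) dvd card (cycle t i)}"
      have "s \<notin> W"
        using tops[OF i] \<open>card (cycle t i) \<noteq> card (cycle t s)\<close> by (auto simp: W_def dest: dvd_antisym)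
      then have WX: "W \<subset> X" using s by (auto simp: W_def)
      have closed_W: "a \<star> b \<in> W" if "a \<in> W" "b \<in> W" for a b
        using that closed card_cycle_mult_dvd t by (simp add: W_def)
      have iW: "i \<in> W" using i by (simp add: W_def)
      have tW: "t \<in> W" using t cycle_self[OF t] by (simp add: W_def)
      have LW: "(\<lambda>x. i \<star> x) ` W = W" using IH WX closed_W iW by blast
      have "finite W" using finite_carrier WX by (meson finite_subset psubset_imp_subset)
      then have inj: "inj_on (\<lambda>x. i \<star> x) W" using LW by (intro eq_card_imp_inj_on) simp_all
      have "(\<lambda>x. i \<star> x) ` (W \<inter> Y) = W \<inter> Y"
        using WX closed_W closed_Y iW iY by (intro IH) auto
      moreover have "i \<star> t \<in> W \<inter> Y" using closed_W iW tW i_to_Y t by blast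
      ultimately obtain z where "z \<in> W \<inter> Y" "i \<star> t = i \<star> z" by blast
      then have "t \<in> Y" using inj tW by (auto dest: inj_onD)
      then show ?thesis using tT by (simp add: Y_def)
    qed
  qed
qed

end

lemma chain_cycle_quandle_left_surj:
  assumes "chain_cycle_quandle X op" "i \<in> X"
  shows "(\<lambda>x. op i x) ` X = X"
  using assms
proof (induction "card X" arbitrary: X i rule: less_induct)
  case less
  interpret chain_cycle_quandle X op by fact
  show ?case
  proof (rule left_translation_surj_step)
    fix Y y assume Y: "Y \<subset> X" "\<And>a b. a \<in> Y \<Longrightarrow> b \<in> Y \<Longrightarrow> op a b \<in> Y" "y \<in> Y"
    have "chain_cycle_quandle Y op" using Y by (intro subquandle) auto
    moreover have "card Y < card X" using finite_carrier Y(1) by (rule psubset_card_mono)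
    ultimately show "(\<lambda>x. op y x) ` Y = Y" using less.hyps Y(3) by simp
  qed fact
qed

section \<open>Super Hayashi quandles are latin\<close>

lemma SHQ_cycle_lengths_chain:
  assumes "SHQ_cycle_lengths ls" "a \<le> b" "b < length ls"
  shows "ls ! a dvd ls ! b \<and> (a < b \<longrightarrow> ls ! a < ls ! b)"
  using assms(2,3)
proof (induction b rule: dec_induct)
  case (step b)
  have "ls ! b < ls ! Suc b \<and> ls ! b dvd ls ! Suc b"
    using assms(1) step.prems unfolding SHQ_cycle_lengths_def
    by (auto dest: spec[of _ "Suc b"])
  then show ?case using step by (auto intro: dvd_trans simp: less_Suc_eq)
qed simp

text \<open>The multiset of cycle lengths has no repetitions, so there are as many cycles as lengths, and
  a cycle is determined by its length.\<close>

lemma chain_cycles_of_cycle_structure: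
  assumes "finite X" "SHQ_cycle_lengths ls" "cycle_structure X f = mset ls"
  shows "chain_cycles X f"
proof -
  let ?F = "Orbits.orbit f ` X"
  have "inj_on ((!) ls) {..<length ls}"
    using SHQ_cycle_lengths_chain[OF assms(2)]
    by (intro linorder_inj_onI) (auto simp: less_le)
  then have dist: "distinct ls"
    by (auto simp: distinct_conv_nth inj_on_def)
  have ms: "image_mset card (mset_set ?F) = mset ls"
    using assms(3) unfolding cycle_structure_def .
  have set: "card ` ?F = set ls"
    using arg_cong[OF ms, of set_mset] assms(1) by simp
  have "card ?F = length ls"
    using arg_cong[OF ms, of size] by simp
  then have inj: "inj_on card ?F"
    using set dist assms(1) by (intro eq_card_imp_inj_on) (auto simp: distinct_card)
  have "m dvd n \<or> n dvd m" if "m \<in> set ls" "n \<in> set ls" for m n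
    using that SHQ_cycle_lengths_chain[OF assms(2)] by (metis in_set_conv_nth nat_le_linear)
  moreover have "card (Orbits.orbit f x) \<in> set ls" if "x \<in> X" for x
    using set that by blast
  ultimately show ?thesis
    using inj unfolding chain_cycles_def by (auto dest: inj_onD)
qed

lemma (in super_hayashi_quandle) chain_cycle_quandle: "chain_cycle_quandle X (\<star>)"
proof
  fix i assume i: "i \<in> X"
  then obtain ls where "SHQ_cycle_lengths ls"
      "cycle_structure X (right_translation X (\<star>) i) = mset ls"
    using SHQ_cycle_structure by blast
  then have "chain_cycles X (right_translation X (\<star>) i)"
    using chain_cycles_of_cycle_structure finite_carrier by blast
  moreover have "Orbits.orbit (right_translation X (\<star>) i) x = Orbits.orbit (\<lambda>x. x \<star> i) x"
    if "x \<in> X" for x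
    using that i closed
    by (intro orbit_cong0[of x X]) (auto simp: right_translation_def)
  ultimately show "chain_cycles X (\<lambda>x. x \<star> i)"
    unfolding chain_cycles_def by simp
qed (rule finite_carrier)

section \<open>Latin quandles are connected\<close>

lemma latin_imp_connected:
  assumes "latin_quandle X op"
  shows "connected_quandle X op"
proof -
  interpret quandle X op using assms by (simp add: latin_quandle_def)
  interpret B: group "BijGroup X" by (rule group_BijGroup)
  let ?R = "right_translation X op ` X"
  let ?G = "right_mult_group X op"
  have R: "?R \<subseteq> carrier (BijGroup X)" using right_translation_Bij by blast
  then have sub: "subgroup (generate (BijGroup X) ?R) (BijGroup X)"
    by (rule B.generate_is_subgroup)
  have "group_hom ?G (BijGroup X) (\<lambda>g. g)"
    unfolding right_mult_group_def
    using B.subgroup_imp_group[OF sub] B.group_axioms subgroup.subset[OF sub]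
    by (auto intro!: group_hom.intro group_hom_axioms.intro simp: hom_def)
  moreover have "\<exists>g \<in> carrier ?G. g i = j" if ij: "i \<in> X" "j \<in> X" for i j
  proof -
    have "j \<in> left_translation X op i ` X"
      using assms ij unfolding latin_quandle_def bij_betw_def by blast
    then obtain x where x: "x \<in> X" "op i x = j" by (auto simp: left_translation_def)
    then have "right_translation X op x i = j" using ij by (simp add: right_translation_def)
    moreover have "right_translation X op x \<in> carrier ?G"
      unfolding right_mult_group_def using x by (simp add: generate.incl)
    ultimately show ?thesis by blast
  qed
  ultimately have "transitive_action ?G X (\<lambda>g. g)"
    by (intro transitive_action.intro group_action.intro transitive_action_axioms.intro)
  then show ?thesis using quandle_axioms by (simp add: connected_quandle_def)
qed

theorem proposition3p2:
  fixes X :: "'a set" and op :: "'a \<Rightarrow> 'a \<Rightarrow> 'a"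
  assumes "super_hayashi_quandle X op"
  shows "latin_quandle X op \<and> connected_quandle X op"
proof -
  interpret super_hayashi_quandle X op by fact
  have "bij_betw (left_translation X op i) X X" if "i \<in> X" for i
  proof -
    have "left_translation X op i ` X = X"
      using chain_cycle_quandle_left_surj[OF chain_cycle_quandle that]
      by (simp add: left_translation_def)
    moreover from this have "inj_on (left_translation X op i) X"
      using finite_carrier by (intro eq_card_imp_inj_on) simp_all
    ultimately show ?thesis by (simp add: bij_betw_def)
  qed
  then have "latin_quandle X op"
    using quandle_axioms by (simp add: latin_quandle_def)
  then show ?thesis using latin_imp_connected by blast
qed

end
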